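(* Let $p_1,\dots,p_r,q_1,\dots,q_s$ be distinct primes, $a_1,\dots,a_r$ and $b_1,\dots,b_s$ positive integers, and let $$n=\prod_{i=1}^r p_i^{2a_i+1}\prod_{j=1}^s q_j^{2b_j},\qquad n_1=\prod_{i=1}^r p_i^{2a_i+1}\prod_{j=1}^s q_j^{b_j-1},\qquad n_2=\prod_{j=1}^s q_j^{b_j+1}.$$ Suppose that $n_1$ is a harmonic number and $n_2$ is a unitary harmonic number. Then $n=n_1n_2$ is a bi-unitary harmonic number.
   Context: $\sigma(n)$, $d(n)$ denote the sum and number of positive divisors of $n$; $n$ is harmonic if $\sigma(n)\mid n\,d(n)$. A divisor $d$ of $n$ is a unitary divisor if $\gcd(d,n/d)=1$; $\sigma^*(n)$, $d^*(n)$ denote the sum and number of unitary divisors of $n$; $n$ is unitary harmonic if $\sigma^*(n)\mid n\,d^*(n)$. A divisor $d$ of $n$ is a bi-unitary divisor if the greatest common unitary divisor of $d$ and $n/d$ is $1$; $\sigma^{**}(n)$, $d^{**}(n)$ denote the sum and number of bi-unitary divisors of $n$; $n$ is bi-unitary harmonic if $\sigma^{**}(n)\mid n\,d^{**}(n)$. *)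

theory Defs
  imports "HOL-Computational_Algebra.Primes"
begin

definition divisor_sum :: "nat \<Rightarrow> nat" where
  "divisor_sum n = (\<Sum>d | d dvd n. d)"

definition divisor_number :: "nat \<Rightarrow> nat" where
  "divisor_number n = card {d. d dvd n}"

(* Positivity is required in the three harmonicity predicates because the divisor
   sums are only meaningful for n > 0; at n = 0 the divisibility would hold as 0 dvd 0. *)
definition harmonic :: "nat \<Rightarrow> bool" where
  "harmonic n \<longleftrightarrow> n > 0 \<and> divisor_sum n dvd n * divisor_number n"

definition unitary_divisor :: "nat \<Rightarrow> nat \<Rightarrow> bool" where
  "unitary_divisor d n \<longleftrightarrow> d dvd n \<and> gcd d (n div d) = 1"

definition unitary_divisor_sum :: "nat \<Rightarrow> nat" where
  "unitary_divisor_sum n = (\<Sum>d | unitary_divisor d n. d)"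

definition unitary_divisor_number :: "nat \<Rightarrow> nat" where
  "unitary_divisor_number n = card {d. unitary_divisor d n}"

definition unitary_harmonic :: "nat \<Rightarrow> bool" where
  "unitary_harmonic n \<longleftrightarrow> n > 0 \<and> unitary_divisor_sum n dvd n * unitary_divisor_number n"

(* For positive m and n the set is finite and contains 1, so Max is the true maximum. *)
definition greatest_common_unitary_divisor :: "nat \<Rightarrow> nat \<Rightarrow> nat" where
  "greatest_common_unitary_divisor m n = Max {c. unitary_divisor c m \<and> unitary_divisor c n}"

definition biunitary_divisor :: "nat \<Rightarrow> nat \<Rightarrow> bool" where
  "biunitary_divisor d n \<longleftrightarrow> d dvd n \<and> greatest_common_unitary_divisor d (n div d) = 1"

definition biunitary_divisor_sum :: "nat \<Rightarrow> nat" where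
  "biunitary_divisor_sum n = (\<Sum>d | biunitary_divisor d n. d)"

definition biunitary_divisor_number :: "nat \<Rightarrow> nat" where
  "biunitary_divisor_number n = card {d. biunitary_divisor d n}"

definition biunitary_harmonic :: "nat \<Rightarrow> bool" where
  "biunitary_harmonic n \<longleftrightarrow> n > 0 \<and> biunitary_divisor_sum n dvd n * biunitary_divisor_number n"

end

theory Submission
  imports Defs
begin

text \<open>
  Write \<open>v\<close> for the exponent of a prime \<open>t\<close> in an integer. A divisor \<open>d\<close> of \<open>n\<close> is bi-unitary iff
  \<open>v(n) = 2 v(d) > 0\<close> for no \<open>t\<close>, and unitary iff always \<open>v(d) \<in> {0, v(n)}\<close>.
  An exponent in \<open>{0..2b}\<close> other than \<open>b\<close> is uniquely the sum of one in \<open>{0..b-1}\<close> and one in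
  \<open>{0, b+1}\<close>, so \<open>(x, y) \<mapsto> x y\<close> is a bijection from pairs of a divisor of \<open>n\<^sub>1\<close> and a unitary
  divisor of \<open>n\<^sub>2\<close> onto the bi-unitary divisors of \<open>n\<close>. Hence
  \<open>\<sigma>\<^sup>*\<^sup>*(n) = \<sigma>(n\<^sub>1) \<sigma>\<^sup>*(n\<^sub>2)\<close> and \<open>d\<^sup>*\<^sup>*(n) = d(n\<^sub>1) d\<^sup>*(n\<^sub>2)\<close>.
\<close>

section \<open>Divisibility and unitary divisors in terms of prime exponents\<close>

lemma multiplicity_div_nat:
  fixes d n t :: nat
  assumes "n > 0" "d dvd n" "prime t"
  shows "multiplicity t n = multiplicity t d + multiplicity t (n div d)"
proof -
  have "n = d * (n div d)" using assms(2) by simp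
  moreover have "d \<noteq> 0" "n div d \<noteq> 0"
    using assms(1,2) by (auto elim: dvdE)
  ultimately show ?thesis
    using assms(3) prime_elem_multiplicity_mult_distrib[of t d "n div d"] by simp
qed

lemma dvd_iff_multiplicity_le_nat:
  fixes d n :: nat
  assumes "d > 0" "n > 0"
  shows "d dvd n \<longleftrightarrow> (\<forall>t. prime t \<longrightarrow> multiplicity t d \<le> multiplicity t n)"
  using assms by (auto intro: multiplicity_le_imp_dvd dvd_imp_multiplicity_le)

text \<open>Coprimality of \<open>d\<close> and \<open>n div d\<close> says that at each prime one
  of their exponents vanishes. The two exponents add up to that of \<open>n\<close>, so the exponent
  of \<open>d\<close> is either zero or the full one.\<close>

lemma unitary_divisor_iff_multiplicity:
  assumes "n > 0"
  shows "unitary_divisor d n \<longleftrightarrow> d dvd n \<and>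
    (\<forall>t. prime t \<longrightarrow> multiplicity t d = 0 \<or> multiplicity t d = multiplicity t n)"
proof (cases "d dvd n")
  case True
  have pos: "d > 0" "n div d > 0"
    using True assms by (auto elim: dvdE intro: Nat.gr0I)
  have "coprime d (n div d) \<longleftrightarrow> (\<forall>t. prime t \<longrightarrow> \<not> (t dvd d \<and> t dvd n div d))"
  proof
    assume "coprime d (n div d)"
    then show "\<forall>t. prime t \<longrightarrow> \<not> (t dvd d \<and> t dvd n div d)"
      using coprime_common_divisor not_prime_unit by blast
  next
    assume no_prime: "\<forall>t. prime t \<longrightarrow> \<not> (t dvd d \<and> t dvd n div d)"
    show "coprime d (n div d)"
      unfolding coprime_iff_gcd_eq_1
      using no_prime prime_factor_nat[of "gcd d (n div d)"] by auto
  qed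
  also have "\<dots> \<longleftrightarrow> (\<forall>t. prime t \<longrightarrow> multiplicity t d = 0 \<or> multiplicity t (n div d) = 0)"
    using pos prime_multiplicity_gt_zero_iff[of _ d] prime_multiplicity_gt_zero_iff[of _ "n div d"]
    by (metis gr0I less_irrefl prime_imp_prime_elem)
  also have "\<dots> \<longleftrightarrow> (\<forall>t. prime t \<longrightarrow> multiplicity t d = 0 \<or> multiplicity t d = multiplicity t n)"
    using multiplicity_div_nat[OF assms True] by auto
  finally show ?thesis
    using True by (simp add: unitary_divisor_def coprime_iff_gcd_eq_1)
qed (simp add: unitary_divisor_def)

lemma unitary_divisor_one: "unitary_divisor 1 n"
  by (simp add: unitary_divisor_def)

text \<open>This supplies common unitary divisors: if two numbers have the same exponent at
  \<open>t\<close>, this one prime power serves both.\<close>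

lemma unitary_divisor_prime_power:
  assumes "n > 0" "prime t"
  shows "unitary_divisor (t ^ multiplicity t n) n"
proof -
  have "multiplicity u (t ^ multiplicity t n) = (if u = t then multiplicity t n else 0)"
    if "prime u" for u
    using that assms(2) by (simp add: multiplicity_distinct_prime_power)
  then show ?thesis
    using assms(1) by (auto simp: unitary_divisor_iff_multiplicity multiplicity_dvd)
qed

text \<open>A prime with the same positive exponent in \<open>m\<close> and \<open>n\<close> yields
  a prime power that is a common unitary divisor above 1. Conversely, at any prime factor of a
  common unitary divisor the exponents in \<open>m\<close> and \<open>n\<close> both equal its
  own.\<close>

lemma greatest_common_unitary_divisor_eq_1_iff:
  assumes "m > 0" "n > 0"
  shows "greatest_common_unitary_divisor m n = 1 \<longleftrightarrow>
    (\<forall>t. prime t \<longrightarrow> multiplicity t m = multiplicity t n \<longrightarrow> multiplicity t m = 0)"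
    (is "?L \<longleftrightarrow> ?R")
proof -
  define C where "C = {c. unitary_divisor c m \<and> unitary_divisor c n}"
  have fin: "finite C"
    by (rule finite_subset[of _ "{c. c dvd m}"]) (use assms in \<open>auto simp: C_def unitary_divisor_def\<close>)
  have one: "1 \<in> C" using unitary_divisor_one by (simp add: C_def)
  have pos: "c > 0" if "c \<in> C" for c
    using that assms by (auto simp: C_def unitary_divisor_def intro: Nat.gr0I)
  \<comment> \<open>All members of \<open>C\<close> are positive and 1 is among them, so a maximum
    of 1 leaves no other member.\<close>
  have "Max C = 1 \<longleftrightarrow> (\<forall>c\<in>C. c = 1)"
  proof
    assume "Max C = 1"
    then show "\<forall>c\<in>C. c = 1"
      using Max_ge[OF fin] pos by (metis One_nat_def Suc_leI le_antisym)
  next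
    assume "\<forall>c\<in>C. c = 1"
    then show "Max C = 1" using Max_in[OF fin] one by blast
  qed
  also have "\<dots> \<longleftrightarrow> ?R"
  proof
    assume C: "\<forall>c\<in>C. c = 1"
    show ?R
    proof (intro allI impI)
      fix t :: nat assume t: "prime t" "multiplicity t m = multiplicity t n"
      have "t ^ multiplicity t m \<in> C"
        using unitary_divisor_prime_power[OF assms(1) t(1)]
          unitary_divisor_prime_power[OF assms(2) t(1)] t(2) by (simp add: C_def)
      then have "t ^ multiplicity t m = 1" using C by blast
      then show "multiplicity t m = 0"
        using t(1) by (metis nat_power_eq_Suc_0_iff One_nat_def not_prime_1)
    qed
  next
    assume R: ?R
    show "\<forall>c\<in>C. c = 1"
    proof (rule ballI, rule ccontr)
      fix c assume c: "c \<in> C" "c \<noteq> 1"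
      obtain t where t: "prime t" "t dvd c" using prime_factor_nat[OF c(2)] by blast
      have "multiplicity t c > 0"
        using t pos[OF c(1)] by (simp add: prime_multiplicity_gt_zero_iff)
      then have "multiplicity t c = multiplicity t m" "multiplicity t c = multiplicity t n"
        using c(1) t(1) assms by (auto simp: C_def unitary_divisor_iff_multiplicity)
      with R t(1) \<open>multiplicity t c > 0\<close> show False by auto
    qed
  qed
  finally show ?thesis
    by (simp add: greatest_common_unitary_divisor_def C_def)
qed

text \<open>The exponents of \<open>d\<close> and \<open>n div d\<close> sum to that of
  \<open>n\<close>, so they agree exactly when \<open>d\<close> takes half of the exponent of
  \<open>n\<close>.\<close>

lemma biunitary_divisor_iff_multiplicity:
  assumes "n > 0"
  shows "biunitary_divisor d n \<longleftrightarrow> d dvd n \<and>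
    (\<forall>t. prime t \<longrightarrow> multiplicity t n = 2 * multiplicity t d \<longrightarrow> multiplicity t n = 0)"
proof (cases "d dvd n")
  case True
  have pos: "d > 0" "n div d > 0"
    using True assms by (auto elim: dvdE intro: Nat.gr0I)
  have "multiplicity t d = multiplicity t (n div d) \<longleftrightarrow> multiplicity t n = 2 * multiplicity t d"
    if "prime t" for t
    using multiplicity_div_nat[OF assms True that] by linarith
  then have "biunitary_divisor d n \<longleftrightarrow>
      (\<forall>t. prime t \<longrightarrow> multiplicity t n = 2 * multiplicity t d \<longrightarrow> multiplicity t d = 0)"
    using True by (simp only: biunitary_divisor_def greatest_common_unitary_divisor_eq_1_iff[OF pos]) blast
  then show ?thesis
    using True by auto
qed (simp add: biunitary_divisor_def)

section \<open>The bijection and its consequence for harmonicity\<close>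

text \<open>Hypothesis \<open>v\<close> keeps only the local data. With \<open>e\<close> the
  exponent of \<open>n1\<close>, the first case gives \<open>n1 * n2\<close> the exponent
  \<open>2 * e + 2\<close>, whose half \<open>e + 1\<close> is the one value that sums of
  \<open>{0..e}\<close> and \<open>{0, e + 2}\<close> miss. In the second case the exponent is zero
  or odd, so no value is excluded.\<close>

lemma bij_betw_biunitary_divisors:
  fixes n1 n2 :: nat
  assumes pos: "n1 > 0" "n2 > 0"
    and v: "\<And>t. prime t \<Longrightarrow> multiplicity t n2 = multiplicity t n1 + 2 \<or>
      multiplicity t n2 = 0 \<and> (multiplicity t n1 = 0 \<or> odd (multiplicity t n1))"
  shows "bij_betw (\<lambda>(x, y). x * y) ({x. x dvd n1} \<times> {y. unitary_divisor y n2})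
    {d. biunitary_divisor d (n1 * n2)}"
proof -
  let ?v = "\<lambda>t::nat. multiplicity t :: nat \<Rightarrow> nat"
  have n: "n1 * n2 > 0" using pos by simp
  have vmult: "?v t (x * y) = ?v t x + ?v t y" if "prime t" "x > 0" "y > 0" for t x y
    using that by (intro prime_elem_multiplicity_mult_distrib) auto
  have dom: "x > 0 \<and> y > 0 \<and> (\<forall>t. prime t \<longrightarrow> ?v t x \<le> ?v t n1 \<and> (?v t y = 0 \<or> ?v t y = ?v t n2))"
    if "x dvd n1" "unitary_divisor y n2" for x y
    using that pos
    by (auto simp: unitary_divisor_iff_multiplicity intro: Nat.gr0I dvd_imp_multiplicity_le)
  have inj: "x = x' \<and> y = y'"
    if "x dvd n1" "unitary_divisor y n2" "x' dvd n1" "unitary_divisor y' n2" "x * y = x' * y'"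
    for x y x' y'
  proof -
    note 1 = dom[OF that(1,2)] and 2 = dom[OF that(3,4)]
    have eq: "?v t x = ?v t x' \<and> ?v t y = ?v t y'" if t: "prime t" for t
    proof -
      have "?v t x + ?v t y = ?v t x' + ?v t y'"
        using vmult[OF t, of x y] vmult[OF t, of x' y'] 1 2 \<open>x * y = x' * y'\<close> by auto
      moreover have "?v t x \<le> ?v t n1" "?v t x' \<le> ?v t n1"
        "?v t y = 0 \<or> ?v t y = ?v t n2" "?v t y' = 0 \<or> ?v t y' = ?v t n2"
        using 1 2 t by blast+
      \<comment> \<open>If the exponents of \<open>y\<close> and \<open>y'\<close> differed, those
        of \<open>x\<close> and \<open>x'\<close> would differ by that of \<open>n2\<close>, which
        is two more than the bound on both.\<close>
      ultimately show ?thesis using v[OF t] by linarith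
    qed
    show ?thesis
      using 1 2 eq multiplicity_eq_nat[of x x'] multiplicity_eq_nat[of y y'] by blast
  qed
  have into: "biunitary_divisor (x * y) (n1 * n2)" if xy: "x dvd n1" "unitary_divisor y n2" for x y
  proof -
    have "x * y dvd n1 * n2" using xy by (auto simp: unitary_divisor_def intro: mult_dvd_mono)
    moreover have "?v t (n1 * n2) = 0" if t: "prime t" "?v t (n1 * n2) = 2 * ?v t (x * y)" for t
    proof -
      have "?v t n1 + ?v t n2 = 2 * (?v t x + ?v t y)"
        using t(2) vmult[OF t(1), of x y] vmult[OF t(1) pos] dom[OF xy] by metis
      moreover have "?v t x \<le> ?v t n1" "?v t y = 0 \<or> ?v t y = ?v t n2"
        using dom[OF xy] t(1) by blast+
      \<comment> \<open>In the first case of \<open>v\<close> the right side would need a sum of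
        \<open>e + 1\<close>, the missing value; in the second, an odd exponent is no
        double.\<close>
      ultimately have "?v t n1 + ?v t n2 = 0"
        using v[OF t(1)] by (elim disjE conjE) simp_all
      then show ?thesis using vmult[OF t(1) pos] by simp
    qed
    ultimately show ?thesis using n by (auto simp: biunitary_divisor_iff_multiplicity)
  qed
  have onto: "\<exists>x y. x dvd n1 \<and> unitary_divisor y n2 \<and> d = x * y"
    if d: "biunitary_divisor d (n1 * n2)" for d
  proof -
    have dn: "d dvd n1 * n2" using d by (simp add: biunitary_divisor_def)
    then have d0: "d > 0" using n by (auto intro: Nat.gr0I)
    \<comment> \<open>\<open>S\<close> collects the primes at which the exponent of \<open>d\<close>
      lies above the gap. There \<open>y\<close> takes the whole exponent of \<open>n2\<close>,
      elsewhere none, and the cofactor \<open>x\<close> is the rest.\<close>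
    define S where "S = {t \<in> prime_factors n2. ?v t n2 \<le> ?v t d}"
    define y where "y = (\<Prod>t\<in>S. t ^ ?v t n2)"
    have vy: "?v t y = (if t \<in> S then ?v t n2 else 0)" if "prime t" for t
      unfolding y_def using that
      by (intro multiplicity_prod_prime_powers) (auto simp: S_def)
    have S: "t \<in> S \<longleftrightarrow> ?v t n2 > 0 \<and> ?v t n2 \<le> ?v t d" if "prime t" for t
      using that by (auto simp: S_def prime_factors_multiplicity)
    have y0: "y > 0" by (auto simp: y_def S_def intro!: prod_pos prime_gt_0_nat)
    have "y dvd n2"
      using y0 pos vy by (auto simp: dvd_iff_multiplicity_le_nat)
    then have "unitary_divisor y n2"
      using pos vy by (auto simp: unitary_divisor_iff_multiplicity)
    have "y dvd d"
      using y0 d0 vy S by (auto simp: dvd_iff_multiplicity_le_nat)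
    then obtain x where x: "d = y * x" by (elim dvdE)
    have x0: "x > 0" using d0 x by (auto intro: Nat.gr0I)
    have "?v t x \<le> ?v t n1" if t: "prime t" for t
    proof -
      have "?v t d = ?v t y + ?v t x" using vmult[OF t y0 x0] x by simp
      moreover have "?v t d \<le> ?v t n1 + ?v t n2"
        using dvd_imp_multiplicity_le[OF dn, of t] n vmult[OF t pos] by simp
      moreover have "?v t n1 + ?v t n2 = 2 * ?v t d \<longrightarrow> ?v t n1 + ?v t n2 = 0"
        using d t n vmult[OF t pos] by (auto simp: biunitary_divisor_iff_multiplicity)
      \<comment> \<open>In the first case of \<open>v\<close>, a prime in \<open>S\<close> leaves at
        most \<open>(2 * e + 2) - (e + 2) = e\<close> for \<open>x\<close>; outside \<open>S\<close>
        the exponent is at most \<open>e + 1\<close>, and bi-unitarity rules out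
        \<open>e + 1\<close>.\<close>
      ultimately show ?thesis
        using v[OF t] vy[OF t] S[OF t] by (auto split: if_splits)
    qed
    then have "x dvd n1" using x0 pos by (simp add: dvd_iff_multiplicity_le_nat)
    then show ?thesis using \<open>unitary_divisor y n2\<close> x by (auto simp: mult.commute)
  qed
  show ?thesis
  proof (rule bij_betw_imageI)
    show "inj_on (\<lambda>(x, y). x * y) ({x. x dvd n1} \<times> {y. unitary_divisor y n2})"
      by (rule inj_onI) (clarsimp, blast dest: inj)
    show "(\<lambda>(x, y). x * y) ` ({x. x dvd n1} \<times> {y. unitary_divisor y n2})
        = {d. biunitary_divisor d (n1 * n2)}"
    proof (intro equalityI subsetI)
      fix d assume "d \<in> {d. biunitary_divisor d (n1 * n2)}"
      then obtain x y where "x dvd n1" "unitary_divisor y n2" "d = x * y"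
        using onto by blast
      then show "d \<in> (\<lambda>(x, y). x * y) ` ({x. x dvd n1} \<times> {y. unitary_divisor y n2})"
        by (intro image_eqI[of _ _ "(x, y)"]) simp_all
    qed (use into in \<open>clarsimp\<close>)
  qed
qed

text \<open>Along the bijection both the divisor sum and the divisor count factor, so the two given
  divisibilities can be multiplied.\<close>

lemma biunitary_harmonic_mult:
  assumes "harmonic n1" "unitary_harmonic n2"
    and v: "\<And>t. prime t \<Longrightarrow> multiplicity t n2 = multiplicity t n1 + 2 \<or>
      multiplicity t n2 = 0 \<and> (multiplicity t n1 = 0 \<or> odd (multiplicity t n1))"
  shows "biunitary_harmonic (n1 * n2)"
proof -
  have pos: "n1 > 0" "n2 > 0" using assms by (simp_all add: harmonic_def unitary_harmonic_def)
  note bij = bij_betw_biunitary_divisors[OF pos v]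
  have "biunitary_divisor_sum (n1 * n2)
      = (\<Sum>(x, y) \<in> {x. x dvd n1} \<times> {y. unitary_divisor y n2}. x * y)"
    unfolding biunitary_divisor_sum_def
    using sum.reindex_bij_betw[OF bij, of "\<lambda>d. d"] by (simp add: case_prod_unfold)
  also have "\<dots> = divisor_sum n1 * unitary_divisor_sum n2"
    by (simp add: divisor_sum_def unitary_divisor_sum_def sum_product sum.cartesian_product)
  finally have sum: "biunitary_divisor_sum (n1 * n2) = divisor_sum n1 * unitary_divisor_sum n2" .
  have num: "biunitary_divisor_number (n1 * n2) = divisor_number n1 * unitary_divisor_number n2"
    using bij_betw_same_card[OF bij]
    by (simp add: biunitary_divisor_number_def divisor_number_def unitary_divisor_number_def
        card_cartesian_product)
  have "divisor_sum n1 * unitary_divisor_sum n2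
      dvd (n1 * divisor_number n1) * (n2 * unitary_divisor_number n2)"
    using assms(1,2) by (intro mult_dvd_mono) (simp_all add: harmonic_def unitary_harmonic_def)
  then show ?thesis
    using pos by (simp add: biunitary_harmonic_def sum num mult_ac)
qed

section \<open>Exponents of the given products and the final case split\<close>

text \<open>Injectivity of \<open>f\<close> allows reindexing by the primes themselves,
  \<open>inv_into\<close> recovering the index of each; then
  \<open>multiplicity_prod_prime_powers\<close> applies.\<close>

lemma multiplicity_prod_indexed_prime_powers:
  fixes f e :: "'i \<Rightarrow> nat"
  assumes "finite I" "\<And>i. i \<in> I \<Longrightarrow> prime (f i)" "inj_on f I"
  shows "prime t \<Longrightarrow> t \<notin> f ` I \<Longrightarrow> multiplicity t (\<Prod>i\<in>I. f i ^ e i) = 0"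
    and "k \<in> I \<Longrightarrow> multiplicity (f k) (\<Prod>i\<in>I. f i ^ e i) = e k"
proof -
  let ?g = "\<lambda>t. e (inv_into I f t)"
  have "(\<Prod>i\<in>I. f i ^ e i) = (\<Prod>t\<in>f ` I. t ^ ?g t)"
    using assms(3) by (subst prod.reindex) (auto intro!: prod.cong)
  then have *: "multiplicity t (\<Prod>i\<in>I. f i ^ e i) = (if t \<in> f ` I then ?g t else 0)" if "prime t" for t
    using that assms
    by (simp only:) (intro multiplicity_prod_prime_powers, auto)
  show "prime t \<Longrightarrow> t \<notin> f ` I \<Longrightarrow> multiplicity t (\<Prod>i\<in>I. f i ^ e i) = 0"
    using * by auto
  show "k \<in> I \<Longrightarrow> multiplicity (f k) (\<Prod>i\<in>I. f i ^ e i) = e k"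
    using *[of "f k"] assms by auto
qed

theorem theorem5:
  fixes r s n n1 n2 :: nat
    and p q a b :: "nat \<Rightarrow> nat"
  assumes "\<And>i. i \<in> {1..r} \<Longrightarrow> prime (p i)"
    and "\<And>j. j \<in> {1..s} \<Longrightarrow> prime (q j)"
    and "inj_on p {1..r}"
    and "inj_on q {1..s}"
    and "p ` {1..r} \<inter> q ` {1..s} = {}"
    and "\<And>i. i \<in> {1..r} \<Longrightarrow> a i > 0"
    and "\<And>j. j \<in> {1..s} \<Longrightarrow> b j > 0"
    and "n = (\<Prod>i=1..r. p i ^ (2 * a i + 1)) * (\<Prod>j=1..s. q j ^ (2 * b j))"
    and "n1 = (\<Prod>i=1..r. p i ^ (2 * a i + 1)) * (\<Prod>j=1..s. q j ^ (b j - 1))"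
    and "n2 = (\<Prod>j=1..s. q j ^ (b j + 1))"
    and "harmonic n1"
    and "unitary_harmonic n2"
  shows "n = n1 * n2 \<and> biunitary_harmonic n"
proof -
  have "(\<Prod>j=1..s. q j ^ (2 * b j)) = (\<Prod>j=1..s. q j ^ (b j - 1)) * (\<Prod>j=1..s. q j ^ (b j + 1))"
    unfolding prod.distrib[symmetric] power_add[symmetric]
  proof (rule prod.cong[OF refl])
    fix j assume "j \<in> {1..s}"
    \<comment> \<open>Positivity of \<open>b j\<close> makes the truncated subtraction
      exact.\<close>
    then have "2 * b j = b j - 1 + (b j + 1)" using assms(7)[of j] by simp
    then show "q j ^ (2 * b j) = q j ^ (b j - 1 + (b j + 1))" by (rule arg_cong)
  qed
  then have n: "n = n1 * n2" using assms(8-10) by simp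
  have "n1 > 0" using assms(11) by (simp add: harmonic_def)
  note vp = multiplicity_prod_indexed_prime_powers[OF finite_atLeastAtMost assms(1) assms(3)]
    and vq = multiplicity_prod_indexed_prime_powers[OF finite_atLeastAtMost assms(2) assms(4)]
  have "multiplicity t n2 = multiplicity t n1 + 2 \<or>
      multiplicity t n2 = 0 \<and> (multiplicity t n1 = 0 \<or> odd (multiplicity t n1))" if t: "prime t" for t
  proof -
    have v1: "multiplicity t n1 = multiplicity t (\<Prod>i=1..r. p i ^ (2 * a i + 1))
        + multiplicity t (\<Prod>j=1..s. q j ^ (b j - 1))"
      using \<open>n1 > 0\<close> t unfolding assms(9)
      by (intro prime_elem_multiplicity_mult_distrib) auto
    \<comment> \<open>A prime \<open>q j\<close> has exponents \<open>b j - 1\<close> and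
      \<open>b j + 1\<close>, which differ by 2 since \<open>b j > 0\<close>; a prime
      \<open>p i\<close> has an odd exponent in \<open>n1\<close> and zero in \<open>n2\<close>; all
      other primes have zero in both.\<close>
    consider j where "j \<in> {1..s}" "t = q j" | i where "i \<in> {1..r}" "t = p i"
      | "t \<notin> p ` {1..r}" "t \<notin> q ` {1..s}" by blast
    then show ?thesis
    proof cases
      case 1
      then have "t \<notin> p ` {1..r}" using assms(5) by blast
      moreover have "b j > 0" using 1 assms(7) by blast
      ultimately show ?thesis
        using v1 vp(1)[OF _ t, of "\<lambda>i. 2 * a i + 1"] vq(2)[OF _ 1(1), of "\<lambda>j. b j - 1"]
          vq(2)[OF _ 1(1), of "\<lambda>j. b j + 1"] 1(2) assms(10) by simp
    next
      case 2
      then have "t \<notin> q ` {1..s}" using assms(5) by blast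
      then show ?thesis
        using v1 vp(2)[OF _ 2(1), of "\<lambda>i. 2 * a i + 1"] vq(1)[OF _ t, of "\<lambda>j. b j - 1"]
          vq(1)[OF _ t, of "\<lambda>j. b j + 1"] 2(2) assms(10) by simp
    next
      case 3
      then show ?thesis
        using v1 vp(1)[OF _ t, of "\<lambda>i. 2 * a i + 1"] vq(1)[OF _ t, of "\<lambda>j. b j - 1"]
          vq(1)[OF _ t, of "\<lambda>j. b j + 1"] assms(10) by simp
    qed
  qed
  then have "biunitary_harmonic (n1 * n2)"
    by (rule biunitary_harmonic_mult[OF assms(11,12)])
  then show ?thesis using n by simp
qed

end
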